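(* Let $A\in\mathbb{R}^{m\times n}$ with $\sigma_{\min}(A)>0$, where $\sigma_{\min}(A)$ is the smallest of its $n$ singular values (so $A$ has full column rank), and let $\bar x\in\mathbb{R}^n$ with $\|\bar x\|_0=k\ge1$. Let $c=\min\{|\bar x_i|:i\in\operatorname{supp}(\bar x)\}$, let $\kappa$ be the condition number of $A$, and set $$q=\Big(1+\tfrac12\|\bar x\|\Big)\Big(1+\tfrac{4(2-\sqrt2)}{c}\|\bar x\|\Big),\qquad p=\kappa\Big(q+\tfrac{2\kappa}{c}\Big),$$ $$\eta=\min\Big\{\tfrac{\sqrt{p^2+4q}-p}{2q},\ \tfrac c2,\ (3-2\sqrt2)\|\bar x\|\Big\}.$$ Let $\tilde y=A\bar x+\varepsilon$ with $\varepsilon\in\mathbb{R}^m$. If $\|\varepsilon\|<\eta\,\sigma_{\min}(A)$, then the semidefinite program $$\min_{X\in\mathbb{S}^{n+1}}\tilde C\bullet X\quad\text{s.t. }X_{11}=1,\ X\in\mathcal{S}_{n+1,k+1},\qquad \tilde C=\begin{pmatrix}\|\tilde y\|^2&-\tilde y^TA\\-A^T\tilde y&A^TA\end{pmatrix},$$ is exact.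
   Context: $\mathbb{S}^N$ is the space of real symmetric $N\times N$ matrices, $A\bullet B=\operatorname{Tr}(B^TA)$, $A\succeq B$ means $A-B$ is positive semidefinite, $\operatorname{diag}(X)$ is the diagonal matrix with the same diagonal as $X$, $\|x\|_0$ is the number of nonzero entries, $\|\cdot\|$ is the Euclidean norm, and $\mathcal{S}_{N,K}=\{X\in\mathbb{S}^N:K\operatorname{diag}(X)\succeq X\succeq0\}$. The condition number is the ratio of the largest to the smallest singular value. The SDP is the relaxation of the homogenized sparse linear regression problem $\min\ \|x_0\tilde y-A\beta\|^2$ over $(x_0;\beta)\in\mathbb{R}^{1+n}$ with $x_0^2=1$ and $\|(x_0;\beta)\|_0\le k+1$ (equivalently $\min\|\tilde y-A\beta\|^2$ over $\|\beta\|_0\le k$). It is exact if every optimal solution $X$ is rank one, $X=zz^T$ with $z=(x_0;\beta)$, $x_0^2=1$, $\|\beta\|_0\le k$ (so that $z$ is optimal for the homogenized problem). *)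

theory Defs
  imports "HOL-Analysis.Analysis"
begin

definition l0norm :: "real^'n \<Rightarrow> nat"
  where "l0norm x = card {i. x $ i \<noteq> 0}"

text \<open>
  The singular values of an \<open>m \<times> n\<close> matrix \<open>A\<close> are the square roots of the \<open>n\<close> eigenvalues of
  the \<open>n \<times> n\<close> matrix \<open>A\<^sup>T A\<close>. They are collected as a set, since multiplicities do not
  affect the extreme ones; \<open>0\<close> belongs to the set exactly when \<open>A\<close> is column rank deficient.
\<close>

definition singular_values :: "real^'n^'m \<Rightarrow> real set"
  where "singular_values A =
    {s. s \<ge> 0 \<and> (\<exists>v. v \<noteq> 0 \<and> (transpose A ** A) *v v = s\<^sup>2 *\<^sub>R v)}"

definition sigma_min :: "real^'n^'m \<Rightarrow> real"
  where "sigma_min A = Min (singular_values A)"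

definition sigma_max :: "real^'n^'m \<Rightarrow> real"
  where "sigma_max A = Max (singular_values A)"

definition cond_number :: "real^'n^'m \<Rightarrow> real"
  where "cond_number A = sigma_max A / sigma_min A"

definition mat_inner :: "real^'n^'m \<Rightarrow> real^'n^'m \<Rightarrow> real"  (infixl \<open>\<bullet>\<^sub>M\<close> 70)
  where "A \<bullet>\<^sub>M B = trace (transpose B ** A)"

definition psd :: "real^'n^'n \<Rightarrow> bool"
  where "psd X \<longleftrightarrow> transpose X = X \<and> (\<forall>v. v \<bullet> (X *v v) \<ge> 0)"

definition loewner_ge :: "real^'n^'n \<Rightarrow> real^'n^'n \<Rightarrow> bool"  (infix \<open>\<succeq>\<close> 50)
  where "A \<succeq> B \<longleftrightarrow> psd (A - B)"

definition diag_part :: "real^'n^'n \<Rightarrow> real^'n^'n"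
  where "diag_part X = (\<chi> i j. if i = j then X $ i $ i else 0)"

definition sparse_sdp_cone :: "nat \<Rightarrow> (real^'n^'n) set"
  where "sparse_sdp_cone K = {X. transpose X = X \<and> real K *\<^sub>R diag_part X \<succeq> X \<and> X \<succeq> 0}"

definition outer_square :: "real^'n \<Rightarrow> real^'n^'n"
  where "outer_square z = (\<chi> i j. z $ i * z $ j)"

text \<open>
  Vectors in \<open>\<real>\<^sup>1\<^sup>+\<^sup>n\<close> and matrices of size \<open>n + 1\<close> are indexed by \<^typ>\<open>'n option\<close>: the index
  \<^const>\<open>None\<close> is the homogenizing coordinate (index 1 in the usual numbering), and \<open>Some i\<close> is
  the coordinate \<open>i\<close> of the regression vector.
\<close>

definition hom_vec :: "real \<Rightarrow> real^'n \<Rightarrow> real^('n option)"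
  where "hom_vec x0 \<beta> = (\<chi> i. case i of None \<Rightarrow> x0 | Some i' \<Rightarrow> \<beta> $ i')"

definition regression_cost :: "real^'n^'m \<Rightarrow> real^'m \<Rightarrow> real^('n option)^('n option)"
  where "regression_cost A y = (\<chi> i j.
    case i of
      None \<Rightarrow> (case j of None \<Rightarrow> (norm y)\<^sup>2 | Some j' \<Rightarrow> - (y v* A) $ j')
    | Some i' \<Rightarrow> (case j of None \<Rightarrow> - (transpose A *v y) $ i'
                 | Some j' \<Rightarrow> (transpose A ** A) $ i' $ j'))"

definition sdp_feasible :: "nat \<Rightarrow> real^('n::finite option)^('n option) \<Rightarrow> bool"
  where "sdp_feasible k X \<longleftrightarrow> X $ None $ None = 1 \<and> X \<in> sparse_sdp_cone (k + 1)"

definition sdp_optimal :: "real^'n^'m \<Rightarrow> real^'m \<Rightarrow> nat \<Rightarrow> real^('n option)^('n option) \<Rightarrow> bool"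
  where "sdp_optimal A y k = is_arg_min (\<lambda>X. regression_cost A y \<bullet>\<^sub>M X) (sdp_feasible k)"

definition sdp_exact :: "real^'n^'m \<Rightarrow> real^'m \<Rightarrow> nat \<Rightarrow> bool"
  where "sdp_exact A y k \<longleftrightarrow> (\<forall>X. sdp_optimal A y k X \<longrightarrow>
    (\<exists>x0 \<beta>. X = outer_square (hom_vec x0 \<beta>) \<and> x0\<^sup>2 = 1 \<and> l0norm \<beta> \<le> k))"

text \<open>
  The homogenized regression problem. The lemmas below show that the semidefinite program relaxes
  it, so that the vectors \<open>(x0; \<beta>)\<close> in \<open>sdp_exact\<close> are optimal for it.
\<close>

definition hom_feasible :: "nat \<Rightarrow> real \<times> (real^'n) \<Rightarrow> bool"
  where "hom_feasible k = (\<lambda>(x0, \<beta>). x0\<^sup>2 = 1 \<and> l0norm (hom_vec x0 \<beta>) \<le> k + 1)"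

definition hom_optimal :: "real^'n^'m \<Rightarrow> real^'m \<Rightarrow> nat \<Rightarrow> real \<times> (real^'n) \<Rightarrow> bool"
  where "hom_optimal A y k =
    is_arg_min (\<lambda>(x0, \<beta>). (norm (x0 *\<^sub>R y - A *v \<beta>))\<^sup>2) (hom_feasible k)"

lemma sum_option: "(\<Sum>i\<in>UNIV. f i) = f None + (\<Sum>i\<in>UNIV. f (Some i))"
  for f :: "'n::finite option \<Rightarrow> real"
  by (simp add: UNIV_option_conv sum.reindex)

lemma l0norm_hom_vec:
  assumes "x0 \<noteq> 0"
  shows "l0norm (hom_vec x0 \<beta>) = Suc (l0norm \<beta>)"
proof -
  have "{i. hom_vec x0 \<beta> $ i \<noteq> 0} = insert None (Some ` {i. \<beta> $ i \<noteq> 0})"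
  proof (rule set_eqI)
    show "i \<in> {i. hom_vec x0 \<beta> $ i \<noteq> 0} \<longleftrightarrow> i \<in> insert None (Some ` {i. \<beta> $ i \<noteq> 0})" for i
      using assms by (cases i) (auto simp: hom_vec_def)
  qed
  then show ?thesis
    by (simp add: l0norm_def card_image)
qed

lemma outer_square_mult: "outer_square z *v v = (z \<bullet> v) *\<^sub>R z"
  by (simp add: vec_eq_iff outer_square_def matrix_vector_mult_def inner_vec_def
      sum_distrib_left mult_ac)

lemma mat_inner_outer_square: "C \<bullet>\<^sub>M outer_square z = z \<bullet> (C *v z)"
  unfolding mat_inner_def trace_def matrix_matrix_mult_def transpose_def outer_square_def
    inner_vec_def matrix_vector_mult_def
  by (simp, subst sum.swap, simp add: sum_distrib_left mult_ac)

lemma regression_cost_outer_square: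
  "regression_cost A y \<bullet>\<^sub>M outer_square (hom_vec x0 \<beta>) = (norm (x0 *\<^sub>R y - A *v \<beta>))\<^sup>2"
proof -
  have row: "regression_cost A y *v hom_vec x0 \<beta> =
      hom_vec (x0 * (norm y)\<^sup>2 - (y v* A) \<bullet> \<beta>)
        ((transpose A ** A) *v \<beta> - x0 *\<^sub>R (transpose A *v y))"
    by (auto simp: vec_eq_iff matrix_vector_mult_def hom_vec_def regression_cost_def sum_option
        inner_vec_def sum_negf split: option.splits)
  have inn: "hom_vec a u \<bullet> hom_vec b v = a * b + u \<bullet> v" for a b u v
    by (simp add: inner_vec_def sum_option hom_vec_def)
  have "\<beta> \<bullet> ((transpose A ** A) *v \<beta>) = (A *v \<beta>) \<bullet> (A *v \<beta>)"
    by (metis dot_lmul_matrix matrix_vector_mul_assoc vector_transpose_matrix transpose_transpose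
        inner_commute transpose_matrix_vector)
  moreover have "\<beta> \<bullet> (transpose A *v y) = y \<bullet> (A *v \<beta>)"
    by (metis dot_lmul_matrix inner_commute transpose_matrix_vector)
  moreover have "(y v* A) \<bullet> \<beta> = y \<bullet> (A *v \<beta>)"
    by (rule dot_lmul_matrix)
  ultimately show ?thesis
    unfolding mat_inner_outer_square row inn
    unfolding power2_norm_eq_inner
    by (simp add: inner_diff_right inner_diff_left inner_commute algebra_simps)
qed

lemma sdp_feasible_outer_square:
  assumes "hom_feasible k (x0, \<beta>)"
  shows "sdp_feasible k (outer_square (hom_vec x0 \<beta>))"
proof -
  define z where "z = hom_vec x0 \<beta>"
  have x0: "x0\<^sup>2 = 1" and card: "l0norm z \<le> k + 1"
    using assms by (auto simp: hom_feasible_def z_def)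
  have q: "(z \<bullet> v)\<^sup>2 \<le> real (k + 1) * (\<Sum>i\<in>UNIV. (z $ i * v $ i)\<^sup>2)" for v
  proof -
    let ?S = "{i. z $ i \<noteq> 0}"
    have "z \<bullet> v = (\<Sum>i\<in>?S. z $ i * v $ i)"
      by (auto simp: inner_vec_def intro!: sum.mono_neutral_right)
    then have "(z \<bullet> v)\<^sup>2 \<le> real (card ?S) * (\<Sum>i\<in>?S. (z $ i * v $ i)\<^sup>2)"
      using sum_squared_le_sum_of_squares[of "\<lambda>i. z $ i * v $ i" ?S] by (simp add: mult.commute)
    also have "\<dots> \<le> real (k + 1) * (\<Sum>i\<in>UNIV. (z $ i * v $ i)\<^sup>2)"
      using card unfolding l0norm_def
      by (intro mult_mono sum_mono2) (auto intro: sum_nonneg)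
    finally show ?thesis .
  qed
  have D: "v \<bullet> (diag_part (outer_square z) *v v) = (\<Sum>i\<in>UNIV. (z $ i * v $ i)\<^sup>2)" for v
    by (simp add: inner_vec_def matrix_vector_mult_def diag_part_def outer_square_def
        if_distrib if_distribR power2_eq_square mult_ac cong: if_cong)
  have "psd (outer_square z)"
    unfolding psd_def outer_square_mult
    by (simp add: vec_eq_iff transpose_def outer_square_def inner_commute)
  moreover have "psd (real (k + 1) *\<^sub>R diag_part (outer_square z) - outer_square z)"
    unfolding psd_def
  proof (intro conjI allI)
    show "transpose (real (k + 1) *\<^sub>R diag_part (outer_square z) - outer_square z) =
        real (k + 1) *\<^sub>R diag_part (outer_square z) - outer_square z"
      by (simp add: vec_eq_iff transpose_def outer_square_def diag_part_def)
    show "0 \<le> v \<bullet> ((real (k + 1) *\<^sub>R diag_part (outer_square z) - outer_square z) *v v)" for v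
      using q[of v]
      by (simp add: matrix_vector_mult_diff_rdistrib scaleR_matrix_vector_assoc[symmetric]
          inner_diff_right D outer_square_mult inner_commute power2_eq_square del: of_nat_add)
  qed
  moreover have "z $ None = x0"
    by (simp add: z_def hom_vec_def)
  ultimately show ?thesis
    using x0 unfolding z_def[symmetric]
    by (auto simp: sdp_feasible_def sparse_sdp_cone_def loewner_ge_def psd_def outer_square_def
        power2_eq_square)
qed

lemma sdp_exact_hom_optimal:
  assumes "sdp_exact A y k" and opt: "sdp_optimal A y k X"
  obtains x0 \<beta> where "X = outer_square (hom_vec x0 \<beta>)" and "hom_optimal A y k (x0, \<beta>)"
proof -
  from assms obtain x0 \<beta> where X: "X = outer_square (hom_vec x0 \<beta>)"
    and f: "x0\<^sup>2 = 1" "l0norm \<beta> \<le> k"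
    by (auto simp: sdp_exact_def)
  have "hom_feasible k (x0, \<beta>)"
    using f l0norm_hom_vec[of x0 \<beta>] by (cases "x0 = 0") (auto simp: hom_feasible_def)
  moreover have "\<not> (norm (w *\<^sub>R y - A *v \<gamma>))\<^sup>2 < (norm (x0 *\<^sub>R y - A *v \<beta>))\<^sup>2"
    if "hom_feasible k (w, \<gamma>)" for w \<gamma>
    using opt sdp_feasible_outer_square[OF that]
    unfolding sdp_optimal_def is_arg_min_def X regression_cost_outer_square[symmetric] by blast
  ultimately have "hom_optimal A y k (x0, \<beta>)"
    by (auto simp: hom_optimal_def is_arg_min_def)
  with X that show thesis by blast
qed

end

theory Submission
  imports Defs
begin

text \<open>
  Write a feasible \<open>X\<close> as \<open>(1, x\<^sup>T; x, x x\<^sup>T + W)\<close> with \<open>W \<succeq> 0\<close>. Its cost is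
  \<open>\<parallel>y - A x\<parallel>\<^sup>2 + A\<^sup>T A \<bullet> W\<close>, where the second term is at least \<open>\<sigma>\<^sub>m\<^sub>i\<^sub>n\<^sup>2 tr W\<close>, and
  \<open>K diag X \<succeq> X\<close> yields the valid cuts \<open>\<Sum>\<^sub>i (2 w\<^sub>i x\<^sub>i - w\<^sub>i\<^sup>2 X\<^sub>i\<^sub>i) \<le> k\<close>. The optimal rank one
  solution comes from the least squares fit \<open>\<beta>\<close> of \<open>y\<close> on the support of \<open>xbar\<close>, and a single cut
  with a multiplier \<open>\<tau>\<close> certifies it: \<open>w\<^sub>i = 1 / \<beta>\<^sub>i\<close> on the support, and off the support
  \<open>\<tau> w\<^sub>i\<close> is the entry \<open>i\<close> of \<open>A\<^sup>T (y - A \<beta>)\<close>. The certificate needs \<open>\<tau> w\<^sub>i\<^sup>2 < \<sigma>\<^sub>m\<^sub>i\<^sub>n\<^sup>2\<close> for all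
  \<open>i\<close>. A suitable \<open>\<tau>\<close> exists once \<open>\<parallel>\<epsilon>\<parallel> (1 + \<kappa>) < c \<sigma>\<^sub>m\<^sub>i\<^sub>n\<close>, which follows from
  \<open>\<eta> \<le> 1 / p \<le> c / (2 \<kappa>\<^sup>2)\<close>.
\<close>

section \<open>Trace inner product and positive semidefinite matrices\<close>

lemma mat_inner_sum: "A \<bullet>\<^sub>M B = (\<Sum>i\<in>UNIV. \<Sum>j\<in>UNIV. A $ i $ j * B $ i $ j)"
  unfolding mat_inner_def trace_def matrix_matrix_mult_def transpose_def
  by (simp, subst sum.swap, simp add: mult.commute)

lemma mat_inner_diff_right: "A \<bullet>\<^sub>M (B - C) = A \<bullet>\<^sub>M B - A \<bullet>\<^sub>M C"
  by (simp add: mat_inner_sum right_diff_distrib sum_subtractf)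

lemma mat_inner_diff_left: "(A - B) \<bullet>\<^sub>M C = A \<bullet>\<^sub>M C - B \<bullet>\<^sub>M C"
  by (simp add: mat_inner_sum left_diff_distrib sum_subtractf)

lemma mat_inner_mat: "mat s \<bullet>\<^sub>M W = s * (\<Sum>i\<in>UNIV. W $ i $ i)"
proof -
  have "(\<Sum>j\<in>UNIV. (if i = j then s else 0) * W $ i $ j) = s * W $ i $ i" for i
    by (simp add: if_distribR if_distrib[of "\<lambda>x. x * _"] cong: if_cong)
  then show ?thesis
    by (simp add: mat_inner_sum mat_def sum_distrib_left)
qed

lemma sym_matrix_inner:
  fixes W :: "real^'n^'n"
  assumes "transpose W = W"
  shows "u \<bullet> (W *v v) = v \<bullet> (W *v u)"
  by (metis assms dot_lmul_matrix inner_commute transpose_matrix_vector)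

lemma sym_matrix_entry:
  assumes "transpose W = W"
  shows "W $ i $ j = W $ j $ i"
proof -
  have "transpose W $ j $ i = W $ i $ j"
    by (simp add: transpose_def)
  then show ?thesis
    by (simp add: assms)
qed

text \<open>The form is nonnegative at every \<open>s *\<^sub>R u + t *\<^sub>R v\<close>. The
  choices \<open>(d, -b)\<close> and \<open>(-b, a)\<close> of \<open>(s, t)\<close> give the
  discriminant bound multiplied by \<open>d\<close> and by \<open>a\<close>; the case in which both
  vanish is settled by \<open>(1, -b)\<close>.\<close>

lemma psd_cauchy_schwarz:
  assumes "psd W"
  shows "(u \<bullet> (W *v v))\<^sup>2 \<le> (u \<bullet> (W *v u)) * (v \<bullet> (W *v v))"
proof -
  define a where "a = u \<bullet> (W *v u)"
  define b where "b = u \<bullet> (W *v v)"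
  define d where "d = v \<bullet> (W *v v)"
  have b': "v \<bullet> (W *v u) = b"
    using assms sym_matrix_inner unfolding psd_def b_def by metis
  have quad: "0 \<le> s\<^sup>2 * a + 2 * s * t * b + t\<^sup>2 * d" for s t
  proof -
    have "0 \<le> (s *\<^sub>R u + t *\<^sub>R v) \<bullet> (W *v (s *\<^sub>R u + t *\<^sub>R v))"
      using assms by (simp add: psd_def)
    also have "\<dots> = s\<^sup>2 * a + 2 * s * t * b + t\<^sup>2 * d"
      by (simp add: matrix_vector_right_distrib matrix_vector_mult_scaleR inner_add_left
          inner_add_right a_def[symmetric] b_def[symmetric] d_def[symmetric] b'
          power2_eq_square algebra_simps)
    finally show ?thesis .
  qed
  have nonneg: "0 \<le> a" "0 \<le> d"
    using quad[of 1 0] quad[of 0 1] by auto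
  have "b\<^sup>2 \<le> a * d"
  proof (cases "a = 0 \<and> d = 0")
    case True
    then show ?thesis
      using quad[of 1 "-b"] by (simp add: power2_eq_square)
  next
    case False
    have "0 \<le> d * (a * d - b\<^sup>2)" "0 \<le> a * (a * d - b\<^sup>2)"
      using quad[of d "-b"] quad[of "-b" a] by (simp_all add: power2_eq_square algebra_simps)
    then show ?thesis
      using False nonneg by (auto simp: zero_le_mult_iff)
  qed
  then show ?thesis
    by (simp add: a_def b_def d_def)
qed

lemma inner_axis_matrix: "axis i 1 \<bullet> (W *v axis j 1) = (W :: real^'n^'n) $ i $ j"
  by (simp add: inner_axis' matrix_vector_mult_basis column_def)

lemma psd_diag_nonneg: "psd W \<Longrightarrow> 0 \<le> W $ i $ i"
  using inner_axis_matrix[of i W i] by (metis psd_def)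

lemma psd_entry_bound:
  assumes "psd W"
  shows "(W $ i $ j)\<^sup>2 \<le> W $ i $ i * W $ j $ j"
  using psd_cauchy_schwarz[OF assms, of "axis i 1" "axis j 1"] by (simp add: inner_axis_matrix)

lemma psd_zero_diag:
  assumes "psd W" and "\<And>i. W $ i $ i = 0"
  shows "W = 0"
  using psd_entry_bound[OF assms(1)] assms(2) by (simp add: vec_eq_iff)

text \<open>One step of the Cholesky elimination lowers the number of nonzero diagonal entries.\<close>

lemma psd_mat_inner_nonneg:
  assumes "psd N" and "psd W"
  shows "0 \<le> N \<bullet>\<^sub>M W"
  using assms(2)
proof (induction "card {i. W $ i $ i \<noteq> 0}" arbitrary: W rule: less_induct)
  case less
  show ?case
  proof (cases "\<forall>i. W $ i $ i = 0")
    case True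
    then show ?thesis
      using psd_zero_diag[OF less.prems] by (simp add: mat_inner_sum)
  next
    case False
    then obtain i where i: "W $ i $ i > 0"
      using psd_diag_nonneg[OF less.prems] by (metis order_le_less)
    \<comment> \<open>With this scaling \<open>outer_square z\<close> agrees with \<open>W\<close>
      in row and column \<open>i\<close>, so that subtracting it clears both. Cauchy-Schwarz against
      \<open>axis i 1\<close> keeps the difference semidefinite.\<close>
    define z where "z = (1 / sqrt (W $ i $ i)) *\<^sub>R (W *v axis i 1)"
    define W' where "W' = W - outer_square z"
    have z: "z \<bullet> v = (v \<bullet> (W *v axis i 1)) / sqrt (W $ i $ i)" for v
      by (simp add: z_def inner_commute)
    have "0 \<le> v \<bullet> (W' *v v)" for v
    proof -
      have "(z \<bullet> v)\<^sup>2 \<le> v \<bullet> (W *v v)"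
        using psd_cauchy_schwarz[OF less.prems, of v "axis i 1"] i
        by (simp add: z power_divide inner_axis_matrix field_simps)
      then show ?thesis
        by (simp add: W'_def matrix_vector_mult_diff_rdistrib inner_diff_right outer_square_mult
            inner_commute power2_eq_square)
    qed
    then have psd': "psd W'"
      using less.prems
      by (simp add: psd_def W'_def vec_eq_iff transpose_def outer_square_def mult.commute)
    have zj: "z $ j = W $ j $ i / sqrt (W $ i $ i)" for j
      by (simp add: z_def matrix_vector_mult_basis column_def)
    have "W' $ i $ i = 0"
      using i by (simp add: W'_def outer_square_def zj)
    \<comment> \<open>A zero on the diagonal forces \<open>W $ j $ i = 0\<close>, so the elimination
      step creates no new nonzero diagonal entry.\<close>
    moreover have "W' $ j $ j = 0" if "W $ j $ j = 0" for j
      using psd_entry_bound[OF less.prems, of j i] that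
      by (simp add: W'_def outer_square_def zj)
    ultimately have "{j. W' $ j $ j \<noteq> 0} \<subset> {j. W $ j $ j \<noteq> 0}"
      using i by force
    then have "0 \<le> N \<bullet>\<^sub>M W'"
      using less.hyps[OF _ psd'] by (simp add: psubset_card_mono)
    moreover have "0 \<le> N \<bullet>\<^sub>M outer_square z"
      using assms(1) by (simp add: mat_inner_outer_square psd_def)
    ultimately show ?thesis
      by (simp add: W'_def mat_inner_diff_right)
  qed
qed

text \<open>Cauchy-Schwarz with \<open>N *v u\<close> as the other vector bounds the fourth power of
  its norm by 0. This turns extremal Rayleigh quotients into eigenvectors.\<close>

lemma psd_kernel:
  assumes "psd N" and "u \<bullet> (N *v u) = 0"
  shows "N *v u = 0"
  using psd_cauchy_schwarz[OF assms(1), of "N *v u" u] assms(2) by simp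

section \<open>Gram matrices, singular values and least squares\<close>

lemma gram_inner: "u \<bullet> ((transpose A ** A) *v v) = (A *v u) \<bullet> (A *v v)"
  for A :: "real^'n^'m"
  by (metis dot_lmul_matrix matrix_vector_mul_assoc transpose_transpose inner_commute
      transpose_matrix_vector)

lemma transpose_gram: "transpose (transpose A ** A) = transpose A ** A"
  for A :: "real^'n^'m"
  by (simp add: matrix_transpose_mul)

lemma transpose_mat: "transpose (mat s) = mat s"
  by (simp add: transpose_def mat_def vec_eq_iff)

lemma mat_mult_vec: "mat s *v v = s *\<^sub>R v" for v :: "real^'n"
  by (simp add: vec_eq_iff matrix_vector_mult_def mat_def if_distribR
      if_distrib[of "\<lambda>x. x * _"] cong: if_cong)

lemma transpose_diff: "transpose (A - B) = transpose A - transpose (B :: real^'n^'m)"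
  by (simp add: transpose_def vec_eq_iff)

lemma psd_gram_minus_mat:
  fixes A :: "real^'n^'m"
  shows "psd (transpose A ** A - mat s) \<longleftrightarrow> (\<forall>v. s * (norm v)\<^sup>2 \<le> (norm (A *v v))\<^sup>2)"
  by (simp add: psd_def transpose_diff transpose_gram transpose_mat
      matrix_vector_mult_diff_rdistrib inner_diff_right gram_inner mat_mult_vec power2_norm_eq_inner)

lemma psd_mat_minus_gram:
  fixes A :: "real^'n^'m"
  shows "psd (mat s - transpose A ** A) \<longleftrightarrow> (\<forall>v. (norm (A *v v))\<^sup>2 \<le> s * (norm v)\<^sup>2)"
  by (simp add: psd_def transpose_diff transpose_gram transpose_mat
      matrix_vector_mult_diff_rdistrib inner_diff_right gram_inner mat_mult_vec power2_norm_eq_inner)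

text \<open>Eigenvectors of the symmetric matrix A^T A for distinct eigenvalues are orthogonal,
  hence independent, hence finite in number. Finiteness is what lets \<open>Min\<close> and
  \<open>Max\<close> yield the extreme singular values.\<close>

lemma finite_singular_values: "finite (singular_values A)"
  for A :: "real^'n^'m"
proof -
  define ev where "ev s = (SOME v. v \<noteq> 0 \<and> (transpose A ** A) *v v = s\<^sup>2 *\<^sub>R v)" for s
  have ev: "ev s \<noteq> 0" "(transpose A ** A) *v ev s = s\<^sup>2 *\<^sub>R ev s" "0 \<le> s"
    if "s \<in> singular_values A" for s
    using that someI_ex[of "\<lambda>v. v \<noteq> 0 \<and> (transpose A ** A) *v v = s\<^sup>2 *\<^sub>R v"]
    by (auto simp: singular_values_def ev_def)
  have orth: "ev s \<bullet> ev t = 0"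
    if "s \<in> singular_values A" "t \<in> singular_values A" "s \<noteq> t" for s t
  proof -
    have "ev s \<bullet> ((transpose A ** A) *v ev t) = ev t \<bullet> ((transpose A ** A) *v ev s)"
      by (rule sym_matrix_inner[OF transpose_gram])
    then have "(t\<^sup>2 - s\<^sup>2) * (ev s \<bullet> ev t) = 0"
      using that ev by (simp add: inner_commute algebra_simps)
    moreover have "t\<^sup>2 \<noteq> s\<^sup>2"
      using that ev(3) by (metis power2_eq_iff_nonneg)
    ultimately show ?thesis by simp
  qed
  have inj: "inj_on ev (singular_values A)"
    using orth ev(1) by (metis inj_onI inner_eq_zero_iff)
  have "pairwise orthogonal (ev ` singular_values A)"
    using orth by (auto simp: pairwise_def orthogonal_def)
  then have "independent (ev ` singular_values A)"
    using ev(1) by (intro pairwise_orthogonal_independent) auto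
  then show ?thesis
    using inj finite_imageD finiteI_independent by blast
qed

text \<open>By compactness the norm of \<open>A *v v\<close> attains its extremes on the unit
  sphere. Shifting A^T A by a squared extreme value gives, up to sign, a semidefinite matrix whose
  form vanishes at the extremal vector, which \<open>psd_kernel\<close> makes an
  eigenvector.\<close>

lemma rayleigh_extrema:
  fixes A :: "real^'n^'m"
  obtains s t where "s \<in> singular_values A" "t \<in> singular_values A"
    "\<And>v. s * norm v \<le> norm (A *v v)" "\<And>v. norm (A *v v) \<le> t * norm v"
proof -
  let ?S = "sphere (0 :: real^'n) 1"
  have cont: "continuous_on ?S (\<lambda>v. norm (A *v v))"
    by (intro continuous_intros linear_continuous_on) (simp add: linear_linear)
  have ne: "?S \<noteq> {}" by simp
  obtain u where u: "norm u = 1" "\<And>v. norm v = 1 \<Longrightarrow> norm (A *v u) \<le> norm (A *v v)"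
    using continuous_attains_inf[OF compact_sphere ne cont] by auto
  obtain w where w: "norm w = 1" "\<And>v. norm v = 1 \<Longrightarrow> norm (A *v v) \<le> norm (A *v w)"
    using continuous_attains_sup[OF compact_sphere ne cont] by auto
  have unit: "norm (A *v v) = norm (A *v ((1 / norm v) *\<^sub>R v)) * norm v" if "v \<noteq> 0" for v
    using that by (simp add: matrix_vector_mult_scaleR)
  have lo: "norm (A *v u) * norm v \<le> norm (A *v v)" for v
  proof (cases "v = 0")
    case False
    then show ?thesis
      using u(2)[of "(1 / norm v) *\<^sub>R v"] by (subst unit) (auto intro: mult_right_mono)
  qed simp
  have hi: "norm (A *v v) \<le> norm (A *v w) * norm v" for v
  proof (cases "v = 0")
    case False
    then show ?thesis
      using w(2)[of "(1 / norm v) *\<^sub>R v"] by (subst unit) (auto intro: mult_right_mono)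
  qed simp
  have "(transpose A ** A - mat ((norm (A *v u))\<^sup>2)) *v u = 0"
  proof (rule psd_kernel)
    show "psd (transpose A ** A - mat ((norm (A *v u))\<^sup>2))"
      unfolding psd_gram_minus_mat by (metis lo mult_nonneg_nonneg norm_ge_zero power_mono
          power_mult_distrib)
    show "u \<bullet> ((transpose A ** A - mat ((norm (A *v u))\<^sup>2)) *v u) = 0"
      using u(1) by (simp add: matrix_vector_mult_diff_rdistrib inner_diff_right gram_inner
          mat_mult_vec power2_norm_eq_inner[symmetric])
  qed
  then have "norm (A *v u) \<in> singular_values A"
    using u(1) unfolding singular_values_def
    by (auto simp: matrix_vector_mult_diff_rdistrib mat_mult_vec intro!: exI[of _ u])
  moreover have "(mat ((norm (A *v w))\<^sup>2) - transpose A ** A) *v w = 0"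
  proof (rule psd_kernel)
    show "psd (mat ((norm (A *v w))\<^sup>2) - transpose A ** A)"
      unfolding psd_mat_minus_gram by (metis hi norm_ge_zero power_mono power_mult_distrib)
    show "w \<bullet> ((mat ((norm (A *v w))\<^sup>2) - transpose A ** A) *v w) = 0"
      using w(1) by (simp add: matrix_vector_mult_diff_rdistrib inner_diff_right gram_inner
          mat_mult_vec power2_norm_eq_inner[symmetric])
  qed
  then have "norm (A *v w) \<in> singular_values A"
    using w(1) unfolding singular_values_def
    by (auto simp: matrix_vector_mult_diff_rdistrib mat_mult_vec intro!: exI[of _ w])
  ultimately show thesis
    using that lo hi by blast
qed

lemma sigma_min_bound: "sigma_min A * norm v \<le> norm (A *v v)"
  for A :: "real^'n^'m"
proof -
  obtain s where s: "s \<in> singular_values A" "s * norm v \<le> norm (A *v v)"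
    by (metis rayleigh_extrema)
  then have "sigma_min A \<le> s"
    by (simp add: sigma_min_def finite_singular_values)
  then show ?thesis
    using s(2) by (meson mult_right_mono norm_ge_zero order_trans)
qed

lemma sigma_max_bound: "norm (A *v v) \<le> sigma_max A * norm v"
  for A :: "real^'n^'m"
proof -
  obtain t where t: "t \<in> singular_values A" "norm (A *v v) \<le> t * norm v"
    by (metis rayleigh_extrema)
  then have "t \<le> sigma_max A"
    by (simp add: sigma_max_def finite_singular_values)
  then show ?thesis
    using t(2) by (meson mult_right_mono norm_ge_zero order_trans)
qed

lemma sigma_min_le_max: "sigma_min A \<le> sigma_max A"
  for A :: "real^'n^'m"
  unfolding sigma_min_def sigma_max_def
  by (metis rayleigh_extrema finite_singular_values Min_le Max_ge order_trans)

text \<open>Orthogonal projection of \<open>y\<close> onto the image under \<open>A\<close> of the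
  vectors supported in \<open>S\<close>; the second property is the normal equations.\<close>

lemma restricted_least_squares:
  fixes A :: "real^'n^'m"
  obtains \<beta> where "\<And>i. i \<notin> S \<Longrightarrow> \<beta> $ i = 0"
    and "\<And>v. (\<And>i. i \<notin> S \<Longrightarrow> v $ i = 0) \<Longrightarrow> (y - A *v \<beta>) \<bullet> (A *v v) = 0"
proof -
  define V where "V = {v :: real^'n. \<forall>i. i \<notin> S \<longrightarrow> v $ i = 0}"
  have "subspace V"
    by (auto simp: V_def subspace_def)
  then have "span ((*v) A ` V) = (*v) A ` V"
    by (simp add: linear_subspace_image matrix_vector_mul_linear span_eq_iff)
  then obtain \<beta> r where "\<beta> \<in> V" "\<And>w. w \<in> (*v) A ` V \<Longrightarrow> orthogonal r w" "y = A *v \<beta> + r"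
    using orthogonal_subspace_decomp_exists[of "(*v) A ` V" y] by (metis imageE)
  then show thesis
    using that[of \<beta>] by (auto simp: V_def orthogonal_def)
qed

section \<open>Block structure of feasible matrices\<close>

lemma hom_vec_quadratic_form:
  fixes X :: "real^('n::finite option)^('n option)"
  assumes sym: "transpose X = X"
  shows "hom_vec t v \<bullet> (X *v hom_vec t v) = t\<^sup>2 * X $ None $ None
    + 2 * t * ((\<chi> i. X $ Some i $ None) \<bullet> v) + v \<bullet> ((\<chi> i j. X $ Some i $ Some j) *v v)"
proof -
  have sX: "X $ None $ Some j = X $ Some j $ None" for j
    by (rule sym_matrix_entry[OF sym])
  define x where "x = (\<chi> i. X $ Some i $ None)"
  define M where "M = (\<chi> i j. X $ Some i $ Some j)"
  have "(X *v hom_vec t v) $ i = hom_vec (t * X $ None $ None + x \<bullet> v) (t *\<^sub>R x + M *v v) $ i" for i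
    by (cases i) (simp_all add: matrix_vector_mult_def sum_option hom_vec_def sX x_def M_def
        inner_vec_def mult.commute)
  then have mult: "X *v hom_vec t v = hom_vec (t * X $ None $ None + x \<bullet> v) (t *\<^sub>R x + M *v v)"
    by (simp add: vec_eq_iff)
  have inner: "hom_vec a u \<bullet> hom_vec b w = a * b + u \<bullet> w" for a b and u w :: "real^'n"
    by (simp add: inner_vec_def sum_option hom_vec_def)
  show ?thesis
    unfolding mult inner x_def[symmetric] M_def[symmetric]
    by (simp add: inner_add_right inner_commute power2_eq_square algebra_simps)
qed

lemma sdp_feasible_schur_psd:
  fixes X :: "real^('n::finite option)^('n option)"
  assumes "sdp_feasible k X"
  shows "psd (\<chi> i j. X $ Some i $ Some j - X $ Some i $ None * X $ Some j $ None)" (is "psd ?W")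
proof -
  define x where "x = (\<chi> i. X $ Some i $ None)"
  define M where "M = (\<chi> i j. X $ Some i $ Some j)"
  have sym: "transpose X = X" and psd: "psd X" and X1: "X $ None $ None = 1"
    using assms by (auto simp: sdp_feasible_def sparse_sdp_cone_def loewner_ge_def)
  have W: "?W = M - outer_square x"
    by (simp add: vec_eq_iff M_def x_def outer_square_def)
  have "X $ i $ j = X $ j $ i" for i j
    by (rule sym_matrix_entry[OF sym])
  then have "transpose ?W = ?W"
    by (simp add: vec_eq_iff transpose_def)
  moreover have "0 \<le> v \<bullet> (?W *v v)" for v
  proof -
    \<comment> \<open>As the corner entry is 1, this first coordinate minimises the form over
      \<open>t\<close>; the minimum is the form of the Schur complement.\<close>
    have "0 \<le> hom_vec (- (x \<bullet> v)) v \<bullet> (X *v hom_vec (- (x \<bullet> v)) v)"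
      using psd by (simp add: psd_def)
    then show ?thesis
      unfolding hom_vec_quadratic_form[OF sym] W x_def[symmetric] M_def[symmetric] X1
      by (simp add: matrix_vector_mult_diff_rdistrib inner_diff_right outer_square_mult
          power2_eq_square inner_commute)
  qed
  ultimately show ?thesis
    by (simp add: psd_def)
qed

lemma diag_part_mult: "(diag_part X *v v) $ i = X $ i $ i * v $ i"
  by (simp add: matrix_vector_mult_def diag_part_def if_distribR if_distrib[of "\<lambda>x. x * _"]
      cong: if_cong)

text \<open>The bound \<open>\<Sum>\<^sub>i x\<^sub>i\<^sup>2 / X\<^sub>i\<^sub>i \<le> k\<close> expresses \<open>K diag X \<succeq> (1; x) (1; x)\<^sup>T\<close>; the cut is its linearisation.\<close>

lemma sdp_feasible_sparsity_cut:
  fixes X :: "real^('n::finite option)^('n option)"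
  assumes "sdp_feasible k X"
  shows "(\<Sum>i\<in>UNIV. 2 * w $ i * X $ Some i $ None - (w $ i)\<^sup>2 * X $ Some i $ Some i) \<le> real k"
proof -
  define x where "x = (\<chi> i. X $ Some i $ None)"
  define M where "M = (\<chi> i j. X $ Some i $ Some j)"
  define Q where "Q = (\<Sum>i\<in>UNIV. (w $ i)\<^sup>2 * X $ Some i $ Some i)"
  let ?D = "real (k + 1) *\<^sub>R diag_part X - X"
  let ?z = "hom_vec 1 w"
  have sym: "transpose X = X" and psd: "psd ?D" and X1: "X $ None $ None = 1"
    using assms by (auto simp: sdp_feasible_def sparse_sdp_cone_def loewner_ge_def)
  have "?z \<bullet> (diag_part X *v ?z) = (\<Sum>i\<in>UNIV. (?z $ i)\<^sup>2 * X $ i $ i)"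
    by (simp add: inner_vec_def diag_part_mult power2_eq_square mult_ac)
  also have "\<dots> = 1 + Q"
    by (simp add: sum_option hom_vec_def X1 Q_def)
  finally have diag: "?z \<bullet> (diag_part X *v ?z) = 1 + Q" .
  have "0 \<le> ?z \<bullet> (?D *v ?z)"
    using psd by (simp add: psd_def)
  then have 1: "1 + 2 * (x \<bullet> w) + w \<bullet> (M *v w) \<le> real (k + 1) * (1 + Q)"
    using hom_vec_quadratic_form[OF sym, of 1 w]
    by (simp add: matrix_vector_mult_diff_rdistrib inner_diff_right diag x_def M_def X1
        scaleR_matrix_vector_assoc[symmetric] del: of_nat_add)
  have "(\<chi> i j. X $ Some i $ Some j - X $ Some i $ None * X $ Some j $ None) = M - outer_square x"
    by (simp add: vec_eq_iff M_def x_def outer_square_def)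
  then have 2: "(x \<bullet> w)\<^sup>2 \<le> w \<bullet> (M *v w)"
    using sdp_feasible_schur_psd[OF assms] unfolding psd_def
    by (simp add: matrix_vector_mult_diff_rdistrib inner_diff_right outer_square_mult
        power2_eq_square inner_commute)
  \<comment> \<open>With \<open>K = k + 1\<close> and \<open>t = x \<bullet> w\<close>, facts 1 and
    2 give \<open>(1 + t)\<^sup>2 \<le> K * (1 + Q)\<close>. The left side is replaced by its
    tangent at \<open>1 + t = K\<close>; dividing by \<open>K\<close> then leaves
    \<open>K - 1 = k\<close> on the right.\<close>
  have "0 \<le> (1 + x \<bullet> w - real (k + 1))\<^sup>2"
    by simp
  then have "real (k + 1) * (2 * (x \<bullet> w) - Q) \<le> real (k + 1) * real k"
    using 1 2 by (simp add: power2_eq_square algebra_simps)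
  then have "2 * (x \<bullet> w) - Q \<le> real k"
    by (simp add: mult_le_cancel_left_pos del: of_nat_add)
  then show ?thesis
    by (simp add: x_def Q_def inner_vec_def sum_subtractf sum_distrib_left mult_ac)
qed

section \<open>Cost of a feasible matrix and the dual certificate\<close>

text \<open>\<open>X\<close> and the rank one matrix of \<open>(1; x)\<close> differ only in the
  lower right block, where the difference is \<open>W\<close>.\<close>

lemma regression_cost_schur:
  fixes A :: "real^'n^'m"
  assumes "X $ None $ None = 1" and sym: "transpose X = X"
    and x: "x = (\<chi> i. X $ Some i $ None)"
    and W: "W = (\<chi> i j. X $ Some i $ Some j - x $ i * x $ j)"
  shows "regression_cost A y \<bullet>\<^sub>M X = (norm (y - A *v x))\<^sup>2 + (transpose A ** A) \<bullet>\<^sub>M W"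
proof -
  have sX: "X $ None $ Some j = X $ Some j $ None" for j
    by (rule sym_matrix_entry[OF sym])
  have "regression_cost A y \<bullet>\<^sub>M X - regression_cost A y \<bullet>\<^sub>M outer_square (hom_vec 1 x) =
      (transpose A ** A) \<bullet>\<^sub>M W"
    unfolding mat_inner_sum sum_option
    by (simp add: regression_cost_def outer_square_def hom_vec_def x W assms(1) sX sum_subtractf
        right_diff_distrib)
  then show ?thesis
    by (simp add: regression_cost_outer_square)
qed

text \<open>
  The numbers \<open>w\<^sub>i\<close> are the slopes of the sparsity cut that is active at \<open>\<beta>\<close>, and \<open>\<tau>\<close> is its
  multiplier. The hypotheses on \<open>y - A \<beta>\<close> are stationarity of the Lagrangian at \<open>\<beta>\<close>, and
  \<open>\<tau> w\<^sub>i\<^sup>2 < s\<close> makes \<open>\<beta>\<close> its unique minimiser.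
\<close>

lemma sdp_exact_dual_certificate:
  fixes A :: "real^'n^'m"
  assumes card: "l0norm \<beta> = k"
    and coercive: "\<And>v. s * (norm v)\<^sup>2 \<le> (norm (A *v v))\<^sup>2"
    and "\<tau> \<ge> 0"
    and slope: "\<And>i. \<tau> * (w $ i)\<^sup>2 < s"
    and on: "\<And>i. \<beta> $ i \<noteq> 0 \<Longrightarrow> w $ i * \<beta> $ i = 1 \<and> (transpose A *v (y - A *v \<beta>)) $ i = 0"
    and off: "\<And>i. \<beta> $ i = 0 \<Longrightarrow> (transpose A *v (y - A *v \<beta>)) $ i = \<tau> * w $ i"
  shows "sdp_exact A y k"
  unfolding sdp_exact_def
proof (intro allI impI)
  fix X
  assume opt: "sdp_optimal A y k X"
  then have feas: "sdp_feasible k X"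
    by (simp add: sdp_optimal_def is_arg_min_def)
  have sym: "transpose X = X" and X1: "X $ None $ None = 1"
    using feas by (auto simp: sdp_feasible_def sparse_sdp_cone_def)
  define r where "r = y - A *v \<beta>"
  define x where "x = (\<chi> i. X $ Some i $ None)"
  define W where "W = (\<chi> i j. X $ Some i $ Some j - x $ i * x $ j)"
  have psdW: "psd W"
    using sdp_feasible_schur_psd[OF feas] by (simp add: W_def x_def)
  have "hom_feasible k (1, \<beta>)"
    using card by (simp add: hom_feasible_def l0norm_hom_vec)
  then have "\<not> regression_cost A y \<bullet>\<^sub>M outer_square (hom_vec 1 \<beta>) < regression_cost A y \<bullet>\<^sub>M X"
    using opt sdp_feasible_outer_square unfolding sdp_optimal_def is_arg_min_def by blast
  then have "(norm (y - A *v x))\<^sup>2 + (transpose A ** A) \<bullet>\<^sub>M W \<le> (norm r)\<^sup>2"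
    by (simp add: regression_cost_outer_square r_def
        regression_cost_schur[OF X1 sym x_def W_def])
  moreover have "s * (\<Sum>i\<in>UNIV. W $ i $ i) \<le> (transpose A ** A) \<bullet>\<^sub>M W"
    using psd_mat_inner_nonneg[of "transpose A ** A - mat s" W] coercive psdW
    by (simp add: psd_gram_minus_mat mat_inner_diff_left mat_inner_mat)
  moreover have "(norm r)\<^sup>2 - 2 * ((transpose A *v r) \<bullet> (x - \<beta>)) + s * (norm (x - \<beta>))\<^sup>2
      \<le> (norm (y - A *v x))\<^sup>2"
  proof -
    have "y - A *v x = r - A *v (x - \<beta>)"
      by (simp add: r_def matrix_vector_mult_diff_distrib)
    moreover have "r \<bullet> (A *v (x - \<beta>)) = (transpose A *v r) \<bullet> (x - \<beta>)"
      by (metis dot_lmul_matrix transpose_matrix_vector)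
    ultimately have "(norm (y - A *v x))\<^sup>2 =
        (norm r)\<^sup>2 - 2 * ((transpose A *v r) \<bullet> (x - \<beta>)) + (norm (A *v (x - \<beta>)))\<^sup>2"
      by (simp add: power2_norm_eq_inner inner_diff_left inner_diff_right inner_commute)
    then show ?thesis
      using coercive[of "x - \<beta>"] by simp
  qed
  moreover have "\<tau> * (\<Sum>i\<in>UNIV. 2 * w $ i * x $ i - (w $ i)\<^sup>2 * (W $ i $ i + (x $ i)\<^sup>2))
      \<le> \<tau> * real k"
    using sdp_feasible_sparsity_cut[OF feas, of w] \<open>\<tau> \<ge> 0\<close>
    by (intro mult_left_mono) (simp_all add: W_def x_def power2_eq_square)
  \<comment> \<open>The right side is what remains after adding up the four inequalities above,
    which make it at most 0. The left side has nonnegative terms, so each of them must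
    vanish.\<close>
  moreover have "(\<Sum>i\<in>UNIV. (s - \<tau> * (w $ i)\<^sup>2) * ((x $ i - \<beta> $ i)\<^sup>2 + W $ i $ i)) =
      s * (\<Sum>i\<in>UNIV. W $ i $ i) + s * (norm (x - \<beta>))\<^sup>2 - 2 * ((transpose A *v r) \<bullet> (x - \<beta>))
      + \<tau> * (\<Sum>i\<in>UNIV. 2 * w $ i * x $ i - (w $ i)\<^sup>2 * (W $ i $ i + (x $ i)\<^sup>2)) - \<tau> * real k"
  proof -
    have "real k = (\<Sum>i\<in>UNIV. if \<beta> $ i \<noteq> 0 then 1 else 0)"
      using card by (simp add: l0norm_def sum.If_cases)
    \<comment> \<open>The identity holds coordinate by coordinate. Off the support the gradient term
      cancels the linear term of the cut; on it the gradient vanishes, and the share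
      \<open>\<tau>\<close> of \<open>\<tau> * real k\<close> completes the square.\<close>
    moreover have "(s - \<tau> * (w $ i)\<^sup>2) * ((x $ i - \<beta> $ i)\<^sup>2 + W $ i $ i) =
        s * W $ i $ i + s * (x $ i - \<beta> $ i)\<^sup>2 - 2 * ((transpose A *v r) $ i * (x $ i - \<beta> $ i))
        + \<tau> * (2 * w $ i * x $ i - (w $ i)\<^sup>2 * (W $ i $ i + (x $ i)\<^sup>2))
        - \<tau> * (if \<beta> $ i \<noteq> 0 then 1 else 0)" for i
    proof (cases "\<beta> $ i = 0")
      case True
      then show ?thesis
        using off[of i] by (simp add: r_def power2_eq_square algebra_simps)
    next
      case False
      then have "(w $ i)\<^sup>2 * (x $ i - \<beta> $ i)\<^sup>2 = (w $ i * x $ i - 1)\<^sup>2"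
        using on[of i] by (simp add: power_mult_distrib[symmetric] algebra_simps)
      then have "\<tau> * ((w $ i)\<^sup>2 * (x $ i - \<beta> $ i)\<^sup>2) = \<tau> * (w $ i * x $ i - 1)\<^sup>2"
        by simp
      then show ?thesis
        using False on[of i] by (simp add: r_def power2_eq_square algebra_simps)
    qed
    ultimately show ?thesis
      unfolding power2_norm_eq_inner inner_vec_def
      by (simp only: sum_distrib_left)
        (simp only: sum.distrib sum_subtractf power2_eq_square vector_minus_component inner_real_def)
  qed
  ultimately have "(\<Sum>i\<in>UNIV. (s - \<tau> * (w $ i)\<^sup>2) * ((x $ i - \<beta> $ i)\<^sup>2 + W $ i $ i)) \<le> 0"
    by linarith
  moreover have nonneg: "0 \<le> (s - \<tau> * (w $ i)\<^sup>2) * ((x $ i - \<beta> $ i)\<^sup>2 + W $ i $ i)" for i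
    using slope[of i] psd_diag_nonneg[OF psdW, of i] by simp
  ultimately have "(s - \<tau> * (w $ i)\<^sup>2) * ((x $ i - \<beta> $ i)\<^sup>2 + W $ i $ i) = 0" for i
    using sum_nonneg_eq_0_iff[of UNIV
        "\<lambda>i. (s - \<tau> * (w $ i)\<^sup>2) * ((x $ i - \<beta> $ i)\<^sup>2 + W $ i $ i)"]
    by (simp add: sum_nonneg antisym)
  then have "(x $ i - \<beta> $ i)\<^sup>2 + W $ i $ i = 0" for i
    using slope[of i] by (metis mult_eq_0_iff diff_gt_0_iff_gt less_irrefl)
  then have eq: "x $ i = \<beta> $ i" "W $ i $ i = 0" for i
    using psd_diag_nonneg[OF psdW, of i] add_nonneg_eq_0_iff[of "(x $ i - \<beta> $ i)\<^sup>2" "W $ i $ i"]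
    by auto
  then have "W = 0"
    using psd_zero_diag[OF psdW] by simp
  then have XSS: "X $ Some i $ Some j = \<beta> $ i * \<beta> $ j" for i j
    using eq(1) by (simp add: W_def vec_eq_iff)
  have XSN: "X $ Some i $ None = \<beta> $ i" for i
    using eq(1)[of i] by (simp add: x_def)
  have XNS: "X $ None $ Some i = \<beta> $ i" for i
    unfolding XSN[symmetric] by (rule sym_matrix_entry[OF sym])
  have "X $ i $ j = outer_square (hom_vec 1 \<beta>) $ i $ j" for i j
    by (cases i; cases j) (simp_all add: outer_square_def hom_vec_def X1 XSS XSN XNS)
  then have "X = outer_square (hom_vec 1 \<beta>)"
    by (simp add: vec_eq_iff)
  then show "\<exists>x0 \<beta>. X = outer_square (hom_vec x0 \<beta>) \<and> x0\<^sup>2 = 1 \<and> l0norm \<beta> \<le> k"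
    using card by (intro exI[of _ 1] exI[of _ \<beta>]) simp
qed

section \<open>From small noise to a certificate\<close>

text \<open>The fit moves each coordinate by at most \<open>d\<close>, leaving at least
  \<open>c - d\<close> on the support, while the gradient entries are at most
  \<open>\<kappa> * d * (sigma_min A)\<^sup>2\<close>. The noise bound says exactly
  \<open>\<kappa> * d < c - d\<close>, which leaves room for a multiplier.\<close>

lemma sdp_exact_small_noise:
  fixes A :: "real^'n^'m"
  assumes \<sigma>: "sigma_min A > 0"
    and c: "\<And>i. xbar $ i \<noteq> 0 \<Longrightarrow> c \<le> \<bar>xbar $ i\<bar>"
    and small: "norm \<epsilon> * (1 + cond_number A) < c * sigma_min A"
  shows "sdp_exact A (A *v xbar + \<epsilon>) (l0norm xbar)"
proof -
  define y where "y = A *v xbar + \<epsilon>"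
  define d where "d = norm \<epsilon> / sigma_min A"
  define \<kappa> where "\<kappa> = cond_number A"
  obtain \<beta> where \<beta>0: "\<And>i. xbar $ i = 0 \<Longrightarrow> \<beta> $ i = 0"
    and orth: "\<And>v. (\<And>i. xbar $ i = 0 \<Longrightarrow> v $ i = 0) \<Longrightarrow> (y - A *v \<beta>) \<bullet> (A *v v) = 0"
    using restricted_least_squares[of "{i. xbar $ i \<noteq> 0}" y A] by auto
  define r where "r = y - A *v \<beta>"
  \<comment> \<open>The noise splits orthogonally into the shift of the fit and the residual, so
    neither is longer than the noise.\<close>
  have "\<epsilon> = A *v (\<beta> - xbar) + r"
    by (simp add: r_def y_def matrix_vector_mult_diff_distrib)
  moreover have "r \<bullet> (A *v (\<beta> - xbar)) = 0"
    using orth[of "\<beta> - xbar"] \<beta>0 by (simp add: r_def)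
  ultimately have pyth: "(norm \<epsilon>)\<^sup>2 = (norm (A *v (\<beta> - xbar)))\<^sup>2 + (norm r)\<^sup>2"
    by (simp add: power2_norm_eq_inner inner_add_left inner_add_right inner_commute)
  have r: "norm r \<le> norm \<epsilon>"
    by (rule power2_le_imp_le) (simp_all add: pyth)
  have "norm (A *v (\<beta> - xbar)) \<le> norm \<epsilon>"
    by (rule power2_le_imp_le) (simp_all add: pyth)
  then have "norm (\<beta> - xbar) \<le> d"
    using sigma_min_bound[of A "\<beta> - xbar"] \<sigma> by (simp add: d_def field_simps)
  then have near: "\<bar>\<beta> $ i - xbar $ i\<bar> \<le> d" for i
    using component_le_norm_cart[of "\<beta> - xbar" i] by simp
  have col: "(transpose A *v r) $ i = r \<bullet> (A *v axis i 1)" for i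
    by (metis dot_lmul_matrix inner_axis inner_real_def mult.right_neutral transpose_matrix_vector)
  have "\<bar>(transpose A *v r) $ i\<bar> \<le> norm r * norm (A *v axis i 1)" for i
    unfolding col by (rule Cauchy_Schwarz_ineq2)
  also have "norm r * norm (A *v axis i 1) \<le> norm \<epsilon> * sigma_max A" for i
    using r sigma_max_bound[of A "axis i 1"] by (intro mult_mono) simp_all
  also have "norm \<epsilon> * sigma_max A = \<kappa> * d * (sigma_min A)\<^sup>2"
    using \<sigma> by (simp add: \<kappa>_def cond_number_def d_def power2_eq_square)
  finally have grad: "\<bar>(transpose A *v r) $ i\<bar> \<le> \<kappa> * d * (sigma_min A)\<^sup>2" for i .
  have "0 \<le> d" "0 \<le> \<kappa>"
    using \<sigma> sigma_min_le_max[of A] by (simp_all add: d_def \<kappa>_def cond_number_def)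
  have "d + \<kappa> * d < c"
    using small \<sigma> by (simp add: d_def \<kappa>_def field_simps)
  then obtain b where b: "\<kappa> * d < b" "b < c - d"
    using dense[of "\<kappa> * d" "c - d"] by auto
  then have "0 < b"
    using \<open>0 \<le> d\<close> \<open>0 \<le> \<kappa>\<close> by (meson mult_nonneg_nonneg order_le_less_trans)
  have large: "b < \<bar>\<beta> $ i\<bar>" if "xbar $ i \<noteq> 0" for i
    using c[OF that] near[of i] b(2) by linarith
  \<comment> \<open>No coordinate on the support is lost, so \<open>\<beta>\<close> has exactly as
    many nonzeros as \<open>xbar\<close>, as the certificate demands.\<close>
  have supp: "\<beta> $ i = 0 \<longleftrightarrow> xbar $ i = 0" for i
    using \<beta>0[of i] large[of i] \<open>0 < b\<close> by fastforce
  \<comment> \<open>For this value the slope condition reads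
    \<open>b < \<bar>\<beta> $ i\<bar>\<close> on the support, and off it that the gradient entry is
    below \<open>b * (sigma_min A)\<^sup>2\<close> in absolute value.\<close>
  define \<tau> where "\<tau> = (sigma_min A * b)\<^sup>2"
  have "0 < \<tau>"
    using \<sigma> \<open>0 < b\<close> by (simp add: \<tau>_def)
  define w where "w = (\<chi> i. if \<beta> $ i \<noteq> 0 then 1 / \<beta> $ i else (transpose A *v r) $ i / \<tau>)"
  have "sdp_exact A y (l0norm xbar)"
  proof (rule sdp_exact_dual_certificate)
    show "l0norm \<beta> = l0norm xbar"
      by (simp add: l0norm_def supp)
    show "(sigma_min A)\<^sup>2 * (norm v)\<^sup>2 \<le> (norm (A *v v))\<^sup>2" for v
      using power_mono[OF sigma_min_bound[of A v], of 2] \<sigma> by (simp add: power_mult_distrib)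
    show "\<tau> * (w $ i)\<^sup>2 < (sigma_min A)\<^sup>2" for i
    proof (cases "\<beta> $ i = 0")
      case True
      have "((transpose A *v r) $ i)\<^sup>2 \<le> (\<kappa> * d * (sigma_min A)\<^sup>2)\<^sup>2"
        using grad[of i] by (metis abs_ge_zero power2_abs power_mono)
      also have "\<dots> < (b * (sigma_min A)\<^sup>2)\<^sup>2"
        using b(1) \<sigma> \<open>0 \<le> d\<close> \<open>0 \<le> \<kappa>\<close> by (intro power_strict_mono) simp_all
      also have "\<dots> = \<tau> * (sigma_min A)\<^sup>2"
        by (simp add: \<tau>_def power2_eq_square)
      finally show ?thesis
        using True \<open>0 < \<tau>\<close> by (simp add: w_def power_divide power2_eq_square[of \<tau>] field_simps)
    next
      case False
      then have "b\<^sup>2 < (\<beta> $ i)\<^sup>2"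
        using power_strict_mono[OF large[of i], of 2] supp[of i] \<open>0 < b\<close> by simp
      then show ?thesis
        using False \<sigma> by (simp add: w_def \<tau>_def power_mult_distrib power_divide field_simps)
    qed
    show "w $ i * \<beta> $ i = 1 \<and> (transpose A *v (y - A *v \<beta>)) $ i = 0" if "\<beta> $ i \<noteq> 0" for i
    proof
      show "w $ i * \<beta> $ i = 1"
        using that by (simp add: w_def)
      \<comment> \<open>A unit vector at a support index is an admissible direction in the normal
        equations.\<close>
      have "axis i 1 $ j = (0 :: real)" if "xbar $ j = 0" for j
        using that \<open>\<beta> $ i \<noteq> 0\<close> supp by (auto simp: axis_def)
      then show "(transpose A *v (y - A *v \<beta>)) $ i = 0"
        using orth[of "axis i 1"] col[of i] by (simp add: r_def)
    qed
    show "(transpose A *v (y - A *v \<beta>)) $ i = \<tau> * w $ i" if "\<beta> $ i = 0" for i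
      using that \<open>0 < \<tau>\<close> by (simp add: w_def r_def)
  qed (use \<open>0 < \<tau>\<close> in simp)
  then show ?thesis
    by (simp add: y_def)
qed

theorem theorem5p3:
  fixes A :: "real^'n^'m" and xbar :: "real^'n" and \<epsilon> ytilde :: "real^'m"
    and k :: nat and c \<kappa> q p \<eta> :: real
  assumes "sigma_min A > 0"
    and "l0norm xbar = k" and "k \<ge> 1"
    and "c = Min ((\<lambda>i. \<bar>xbar $ i\<bar>) ` {i. xbar $ i \<noteq> 0})"
    and "\<kappa> = cond_number A"
    and "q = (1 + 1/2 * norm xbar) * (1 + 4 * (2 - sqrt 2) / c * norm xbar)"
    and "p = \<kappa> * (q + 2 * \<kappa> / c)"
    and "\<eta> = Min {(sqrt (p\<^sup>2 + 4 * q) - p) / (2 * q), c / 2, (3 - 2 * sqrt 2) * norm xbar}"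
    and "ytilde = A *v xbar + \<epsilon>"
    and "norm \<epsilon> < \<eta> * sigma_min A"
  shows "sdp_exact A ytilde k"
proof -
  have "{i. xbar $ i \<noteq> 0} \<noteq> {}"
    using assms(2,3) unfolding l0norm_def by (metis card.empty not_one_le_zero)
  then have "c \<in> (\<lambda>i. \<bar>xbar $ i\<bar>) ` {i. xbar $ i \<noteq> 0}"
    unfolding assms(4) by (intro Min_in) auto
  then have "0 < c" by auto
  have c: "c \<le> \<bar>xbar $ i\<bar>" if "xbar $ i \<noteq> 0" for i
    using that by (simp add: assms(4))
  have "1 \<le> \<kappa>"
    using assms(1) sigma_min_le_max[of A] by (simp add: assms(5) cond_number_def)
  have "sqrt 2 \<le> 2"
    by (rule real_le_lsqrt) simp_all
  then have "0 < q"
    using \<open>0 < c\<close> by (simp add: assms(6) add_pos_nonneg)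
  then have "0 \<le> p"
    using \<open>1 \<le> \<kappa>\<close> \<open>0 < c\<close> by (simp add: assms(7))
  \<comment> \<open>The nonnegative root of \<open>q * h\<^sup>2 + p * h = 1\<close>; dropping the
    quadratic term gives \<open>p * h \<le> 1\<close>.\<close>
  define h where "h = (sqrt (p\<^sup>2 + 4 * q) - p) / (2 * q)"
  have root: "q * h\<^sup>2 + p * h = 1"
  proof -
    have "2 * q * h + p = sqrt (p\<^sup>2 + 4 * q)"
      using \<open>0 < q\<close> by (simp add: h_def)
    then have "(2 * q * h + p)\<^sup>2 = p\<^sup>2 + 4 * q"
      using \<open>0 < q\<close> by simp
    then have "4 * q * (q * h\<^sup>2 + p * h) = 4 * q * 1"
      by (simp add: power2_eq_square algebra_simps)
    then show ?thesis
      using \<open>0 < q\<close> by simp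
  qed
  have "0 \<le> h"
    using \<open>0 < q\<close> \<open>0 \<le> p\<close> by (simp add: h_def real_le_rsqrt)
  have "1 * \<kappa> \<le> \<kappa> * \<kappa>"
    using \<open>1 \<le> \<kappa>\<close> by (intro mult_right_mono) simp_all
  \<comment> \<open>This bounds the factor \<open>1 + \<kappa>\<close> of the noise condition by the
    summand \<open>2 * \<kappa>\<^sup>2 / c\<close> of \<open>p\<close>, after division by
    \<open>c\<close>.\<close>
  then have "1 + \<kappa> \<le> 2 * \<kappa>\<^sup>2"
    using \<open>1 \<le> \<kappa>\<close> unfolding power2_eq_square by linarith
  then have "(1 + \<kappa>) / c \<le> 2 * \<kappa>\<^sup>2 / c"
    using \<open>0 < c\<close> by (intro divide_right_mono) simp_all
  also have "\<dots> \<le> p"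
    using \<open>1 \<le> \<kappa>\<close> \<open>0 < q\<close> by (simp add: assms(7) power2_eq_square algebra_simps)
  finally have "(1 + \<kappa>) / c * h \<le> p * h"
    using \<open>0 \<le> h\<close> by (rule mult_right_mono)
  also have "\<dots> \<le> 1"
    using root \<open>0 < q\<close> by (smt (verit) mult_nonneg_nonneg zero_le_power2)
  finally have h: "h * (1 + \<kappa>) \<le> c"
    using \<open>0 < c\<close> by (simp add: field_simps)
  have "\<eta> \<le> h"
    by (simp add: assms(8) h_def)
  then have "norm \<epsilon> < h * sigma_min A"
    using assms(1,10) by (smt (verit) mult_right_mono)
  then have "norm \<epsilon> * (1 + \<kappa>) < h * sigma_min A * (1 + \<kappa>)"
    using \<open>1 \<le> \<kappa>\<close> by simp
  also have "\<dots> \<le> c * sigma_min A"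
    using mult_right_mono[OF h, of "sigma_min A"] assms(1) by (simp add: mult_ac)
  finally show ?thesis
    using sdp_exact_small_noise[OF assms(1) c] assms(2,5,9) by blast
qed

end
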